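(* Let $q\ge2$ be an integer, and let $\{W_N\}_{N\ge1}$ be a sequence of random variables such that $W_N\sim\mathrm{Bin}(N,p)$ with $p=\frac{q-1}q$. Then, for every fixed integer $d\ge0$, $$\frac{K_d^{(q)}(W_N;N)}{\sqrt{(q-1)^d\binom Nd}}\ \overset{D}{\longrightarrow}\ \frac{\mathrm{He}_d(Z)}{\sqrt{d!}},\qquad N\to\infty,$$ where $Z$ is a standard (real) Gaussian random variable and $\overset{D}{\longrightarrow}$ denotes convergence in distribution.
   Context: For $d,h\in\{0,\ldots,N\}$ the $q$-ary Krawtchouk polynomial is $K_d^{(q)}(h;N)=\sum_{j=0}^{\min(d,h)}(-1)^j(q-1)^{d-j}\binom hj\binom{N-h}{d-j}$, with $K_0^{(q)}(h;N)=1$ (the expression in the limit is considered for $N\ge d$). $\mathrm{He}_d$ is the $d$-th probabilists' Hermite polynomial, given by $e^{xt-t^2/2}=\sum_{m\ge0}\mathrm{He}_m(x)t^m/m!$. *)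

theory Defs
  imports "HOL-Probability.Probability" "HOL-Computational_Algebra.Formal_Power_Series"
begin

text \<open>
  \<open>krawtchouk q d h N\<close> is $K_d^{(q)}(h;N)$. It is meaningful for \<open>d, h \<le> N\<close> only, where no natural
  number subtraction below truncates.
\<close>

definition krawtchouk :: "nat \<Rightarrow> nat \<Rightarrow> nat \<Rightarrow> nat \<Rightarrow> real" where
  "krawtchouk q d h N =
     (\<Sum>j = 0..min d h. (-1) ^ j * (real q - 1) ^ (d - j)
        * real (h choose j) * real ((N - h) choose (d - j)))"

lemma krawtchouk_0: "krawtchouk q 0 h N = 1"
  by (simp add: krawtchouk_def)

text \<open>
  The probabilists' Hermite polynomials, read off from the generating function
  \<open>exp (x t - t^2 / 2)\<close> as a formal power series in \<open>t\<close>. The theorem \<open>hermite_sums\<close> below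
  shows that the identity also holds for the convergent series, at every real \<open>t\<close>.
\<close>

definition hermite_He :: "nat \<Rightarrow> real \<Rightarrow> real" where
  "hermite_He d x =
     fact d * fps_nth (fps_exp 1 oo (fps_const x * fps_X - fps_const (1 / 2) * fps_X ^ 2)) d"

lemma fps_linear_ODE_unique:
  fixes a b c :: "real fps"
  assumes a: "fps_deriv a = c * a" and b: "fps_deriv b = c * b" and 0: "fps_nth a 0 = fps_nth b 0"
  shows "a = b"
proof (rule fps_ext)
  fix n show "fps_nth a n = fps_nth b n"
  proof (induction n rule: less_induct)
    case (less n)
    show ?case
    proof (cases n)
      case (Suc m)
      have "real (Suc m) * fps_nth a (Suc m) = fps_nth (c * a) m"
        by (simp flip: a)
      also have "\<dots> = fps_nth (c * b) m"
        unfolding fps_mult_nth using less Suc by (intro sum.cong) auto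
      also have "\<dots> = real (Suc m) * fps_nth b (Suc m)"
        by (simp flip: b)
      finally show ?thesis using Suc by (simp del: of_nat_Suc)
    qed (use 0 in simp)
  qed
qed

lemma hermite_fps_factor:
  fixes x :: real
  shows "fps_exp 1 oo (fps_const x * fps_X - fps_const (1 / 2) * fps_X ^ 2)
       = fps_exp x * (fps_exp (- 1 / 2) oo fps_X ^ 2)"
proof (rule fps_linear_ODE_unique[where c = "fps_const x - fps_X"])
  have two: "fps_const (1 / 2 :: real) * 2 = 1" "fps_const (- 1 / 2 :: real) * 2 = -1"
    by (simp_all add: numeral_fps_const flip: fps_const_neg)
  show "fps_deriv (fps_exp 1 oo (fps_const x * fps_X - fps_const (1 / 2) * fps_X ^ 2))
     = (fps_const x - fps_X) * (fps_exp 1 oo (fps_const x * fps_X - fps_const (1 / 2) * fps_X ^ 2))"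
    using two by (simp add: fps_compose_deriv fps_deriv_power' flip: mult.assoc)
  show "fps_deriv (fps_exp x * (fps_exp (- 1 / 2) oo fps_X ^ 2))
     = (fps_const x - fps_X) * (fps_exp x * (fps_exp (- 1 / 2) oo fps_X ^ 2))"
  proof -
    have "fps_deriv (fps_exp (- 1 / 2) oo fps_X ^ 2 :: real fps)
        = fps_const (- 1 / 2) * 2 * fps_X * (fps_exp (- 1 / 2) oo fps_X ^ 2)"
      by (simp add: fps_compose_deriv fps_deriv_power' fps_compose_mult_distrib mult_ac
            del: fps_const_neg)
    then have "fps_deriv (fps_exp (- 1 / 2) oo fps_X ^ 2 :: real fps)
        = - fps_X * (fps_exp (- 1 / 2) oo fps_X ^ 2)"
      unfolding two by simp
    then show ?thesis by (simp add: algebra_simps)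
  qed
qed simp

lemma fps_nth_compose_X_square:
  fixes f :: "real fps"
  shows "fps_nth (f oo fps_X ^ 2) n = (if even n then fps_nth f (n div 2) else 0)"
proof -
  have "fps_nth (f oo fps_X ^ 2) n = (\<Sum>i = 0..n. if n = 2 * i then fps_nth f i else 0)"
    unfolding fps_compose_nth by (intro sum.cong) (auto simp flip: power_mult)
  also have "\<dots> = (\<Sum>i\<in>{0..n} \<inter> {i. n = 2 * i}. fps_nth f i)"
    by (simp add: sum.inter_restrict)
  also have "{0..n} \<inter> {i. n = 2 * i} = (if even n then {n div 2} else {})"
    by auto
  finally show ?thesis by simp
qed

lemma hermite_sums:
  "(\<lambda>m. hermite_He m x * t ^ m / fact m) sums exp (x * t - t ^ 2 / 2)"
proof -
  define a where "a = (\<lambda>n. fps_nth (fps_exp x) n * t ^ n)"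
  define b where "b = (\<lambda>n. fps_nth (fps_exp (- 1 / 2) oo fps_X ^ 2) n * t ^ n)"
  have a_eq: "a = (\<lambda>n. (x * t) ^ n /\<^sub>R fact n)"
    by (simp add: a_def fun_eq_iff power_mult_distrib divide_inverse)
  have a: "a sums exp (x * t)"
    unfolding a_eq by (rule exp_converges)
  have sa: "summable (\<lambda>n. norm (a n))"
    unfolding a_eq by (rule summable_norm_exp)
  have mono: "strict_mono (\<lambda>n::nat. 2 * n)"
    by (simp add: strict_mono_def)
  have b0: "b n = 0" if "n \<notin> range (\<lambda>n. 2 * n)" for n
    using that by (auto simp: b_def fps_nth_compose_X_square)
  have b_eq: "(\<lambda>n. b (2 * n)) = (\<lambda>n. (- (t ^ 2) / 2) ^ n /\<^sub>R fact n)"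
  proof
    fix n
    have *: "(c * t ^ 2) ^ n /\<^sub>R fact n = c ^ n / fact n * t ^ (2 * n)" for c :: real
      by (simp add: power_mult_distrib power_mult divide_inverse)
    have "b (2 * n) = (- 1 / 2) ^ n / fact n * t ^ (2 * n)"
      unfolding b_def fps_nth_compose_X_square fps_exp_nth by simp
    then show "b (2 * n) = (- (t ^ 2) / 2) ^ n /\<^sub>R fact n"
      using *[of "- 1 / 2"] by simp
  qed
  have b: "b sums exp (- (t ^ 2) / 2)"
    using exp_converges[of "- (t ^ 2) / 2"] sums_mono_reindex[OF mono, of b] b0
    unfolding b_eq[symmetric] by auto
  have sb: "summable (\<lambda>n. norm (b n))"
    using summable_norm_exp[of "- (t ^ 2) / 2"]
      summable_mono_reindex[OF mono, of "\<lambda>n. norm (b n)"] b0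
    unfolding fun_cong[OF b_eq, symmetric] by auto
  have "(\<lambda>n. \<Sum>i\<le>n. a i * b (n - i)) sums ((\<Sum>n. a n) * (\<Sum>n. b n))"
    by (rule Cauchy_product_sums[OF sa sb])
  also have "(\<Sum>n. a n) * (\<Sum>n. b n) = exp (x * t - t ^ 2 / 2)"
    using a b by (simp add: sums_iff flip: exp_add)
  also have "(\<lambda>n. \<Sum>i\<le>n. a i * b (n - i)) = (\<lambda>m. hermite_He m x * t ^ m / fact m)"
  proof
    fix n
    have "(\<Sum>i\<le>n. a i * b (n - i)) = fps_nth (fps_exp x * (fps_exp (- 1 / 2) oo fps_X ^ 2)) n * t ^ n"
      unfolding fps_mult_nth sum_distrib_right atMost_atLeast0 a_def b_def
    proof (rule sum.cong)
      fix i assume "i \<in> {0..n}"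
      then have "t ^ n = t ^ i * t ^ (n - i)" by (simp flip: power_add)
      then show "fps_nth (fps_exp x) i * t ^ i * (fps_nth (fps_exp (- 1 / 2) oo fps_X ^ 2) (n - i) * t ^ (n - i))
          = fps_nth (fps_exp x) i * fps_nth (fps_exp (- 1 / 2) oo fps_X ^ 2) (n - i) * t ^ n"
        by (simp only: mult_ac)
    qed simp
    then show "(\<Sum>i\<le>n. a i * b (n - i)) = hermite_He n x * t ^ n / fact n"
      unfolding hermite_He_def hermite_fps_factor by simp
  qed
  finally show ?thesis .
qed

end

theory Submission
  imports Defs "HOL-Real_Asymp.Real_Asymp"
begin

text \<open>
  In the variable \<open>x = ((q - 1) N - q h) / sqrt ((q - 1) N)\<close>, the three-term recurrence of the
  normalised Krawtchouk polynomials has coefficients that converge to those of the Hermite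
  recurrence. So the normalised polynomials converge along every convergent sequence of arguments.
  At \<open>h = W_N\<close> the variable \<open>x\<close> is minus the standardised binomial variable, which is
  asymptotically standard normal, and Skorohod's representation turns this weak convergence into
  pointwise convergence.
\<close>

section \<open>Weak convergence under varying maps, and symmetry of the Gaussian law\<close>

lemma weak_conv_m_cong:
  assumes "\<forall>\<^sub>F n in sequentially. \<mu> n = \<nu> n"
  shows "weak_conv_m \<mu> M \<longleftrightarrow> weak_conv_m \<nu> M"
proof -
  have "(\<lambda>n. cdf (\<mu> n) x) \<longlonglongrightarrow> c \<longleftrightarrow> (\<lambda>n. cdf (\<nu> n) x) \<longlonglongrightarrow> c" for x c
    by (rule tendsto_cong) (use assms in eventually_elim, simp)
  then show ?thesis
    unfolding weak_conv_m_def weak_conv_def by simp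
qed

text \<open>An extended continuous mapping theorem. Skorohod puts all the laws on one probability
  space, where the variables converge pointwise; \<open>fg\<close> carries this over to the images
  under the changing maps. Testing against bounded continuous functions and dominated convergence
  then returns to weak convergence.\<close>

lemma weak_conv_m_distr_varying:
  fixes f :: "nat \<Rightarrow> real \<Rightarrow> real" and g :: "real \<Rightarrow> real"
  assumes \<mu>: "\<And>n. real_distribution (\<mu> n)" and M: "real_distribution M"
    and conv: "weak_conv_m \<mu> M"
    and f [measurable]: "\<And>n. f n \<in> borel_measurable borel"
    and g [measurable]: "g \<in> borel_measurable borel"
    and fg: "\<And>X x. X \<longlonglongrightarrow> x \<Longrightarrow> (\<lambda>n. f n (X n)) \<longlonglongrightarrow> g x"
  shows "weak_conv_m (\<lambda>n. distr (\<mu> n) borel (f n)) (distr M borel g)"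
proof -
  from Skorohod[OF \<mu> M conv] obtain \<Omega> :: "real measure" and Y Y' where \<Omega>: "prob_space \<Omega>"
    and Y [measurable]: "\<And>n. Y n \<in> borel_measurable \<Omega>" and dY: "\<And>n. distr \<Omega> borel (Y n) = \<mu> n"
    and Y': "Y' \<in> measurable \<Omega> lborel" and dY': "distr \<Omega> borel Y' = M"
    and lim: "\<And>\<omega>. \<omega> \<in> space \<Omega> \<Longrightarrow> (\<lambda>n. Y n \<omega>) \<longlonglongrightarrow> Y' \<omega>"
    by metis
  interpret prob_space \<Omega> by fact
  have [measurable]: "Y' \<in> borel_measurable \<Omega>" using Y' by simp
  have f_eq: "distr (\<mu> n) borel (f n) = distr \<Omega> borel (\<lambda>\<omega>. f n (Y n \<omega>))" for n
    unfolding dY[symmetric] by (subst distr_distr) (auto simp: comp_def)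
  have g_eq: "distr M borel g = distr \<Omega> borel (\<lambda>\<omega>. g (Y' \<omega>))"
    unfolding dY'[symmetric] by (subst distr_distr) (auto simp: comp_def)
  show ?thesis
    unfolding f_eq g_eq
  proof (rule integral_bdd_continuous_conv_imp_weak_conv)
    fix h :: "real \<Rightarrow> real"
    assume h: "\<And>x. isCont h x" "\<And>x. \<bar>h x\<bar> \<le> 1"
    have [measurable]: "h \<in> borel_measurable borel"
      using h by (intro borel_measurable_continuous_onI continuous_at_imp_continuous_on) auto
    have "(\<lambda>n. \<integral>\<omega>. h (f n (Y n \<omega>)) \<partial>\<Omega>) \<longlonglongrightarrow> (\<integral>\<omega>. h (g (Y' \<omega>)) \<partial>\<Omega>)"
    proof (rule integral_dominated_convergence[where w = "\<lambda>_. 1"])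
      show "AE \<omega> in \<Omega>. (\<lambda>n. h (f n (Y n \<omega>))) \<longlonglongrightarrow> h (g (Y' \<omega>))"
        by (intro AE_I2 isCont_tendsto_compose[OF h(1)] fg lim)
    qed (use h in auto)
    then show "(\<lambda>n. integral\<^sup>L (distr \<Omega> borel (\<lambda>\<omega>. f n (Y n \<omega>))) h)
        \<longlonglongrightarrow> integral\<^sup>L (distr \<Omega> borel (\<lambda>\<omega>. g (Y' \<omega>))) h"
      by (simp add: integral_distr)
  qed (auto intro!: real_distribution_distr)
qed

text \<open>The characteristic function is real and even, and it determines the law. This absorbs
  the sign between the Krawtchouk variable and the standardised binomial one.\<close>

lemma distr_std_normal_uminus: "distr std_normal_distribution borel uminus = std_normal_distribution"
proof (rule Levy_uniqueness)
  interpret real_distribution std_normal_distribution by (rule real_dist_normal_dist)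
  show "real_distribution (distr std_normal_distribution borel uminus)"
    by (rule real_distribution_distr) simp
  have "char (distr std_normal_distribution borel uminus) t = char std_normal_distribution (- t)" for t
    unfolding char_def by (subst integral_distr) simp_all
  then show "char (distr std_normal_distribution borel uminus) = char std_normal_distribution"
    by (simp add: fun_eq_iff char_std_normal_distribution)
qed (rule real_dist_normal_dist)

section \<open>The central limit theorem for binomial variables\<close>

lemma char_distr_binomial_pmf:
  assumes p: "0 \<le> p" "p \<le> 1"
  shows "char (distr (measure_pmf (binomial_pmf n p)) borel (\<lambda>k. (real k - real n * p) / s)) t
    = (complex_of_real p * iexp ((1 - p) * (t / s))
        + complex_of_real (1 - p) * iexp (- p * (t / s))) ^ n"
proof -
  define u where "u = t / s"
  have "char (distr (measure_pmf (binomial_pmf n p)) borel (\<lambda>k. (real k - real n * p) / s)) t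
      = (CLINT k|measure_pmf (binomial_pmf n p). iexp (t * ((real k - real n * p) / s)))"
    unfolding char_def by (subst integral_distr) simp_all
  also have "\<dots> = (\<Sum>k\<le>n. pmf (binomial_pmf n p) k *\<^sub>R iexp (t * ((real k - real n * p) / s)))"
    using p set_pmf_binomial_eq[of p n] by (intro integral_measure_pmf) (auto split: if_splits)
  also have "\<dots> = (\<Sum>k\<le>n. of_nat (n choose k) * (complex_of_real p * iexp ((1 - p) * u)) ^ k
      * (complex_of_real (1 - p) * iexp (- p * u)) ^ (n - k))"
  proof (rule sum.cong)
    fix k assume "k \<in> {..n}"
    then have k: "k \<le> n" by simp
    \<comment> \<open>The centring is shared out among the trials: each of the \<open>k\<close>
      successes contributes \<open>1 - p\<close> and each of the \<open>n - k\<close> failures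
      \<open>- p\<close>. The sum then has the shape of the binomial theorem.\<close>
    have "t * ((real k - real n * p) / s) = real k * ((1 - p) * u) + real (n - k) * (- p * u)"
      using k by (simp add: u_def of_nat_diff add_divide_distrib diff_divide_distrib algebra_simps)
    then have "iexp (t * ((real k - real n * p) / s)) = iexp ((1 - p) * u) ^ k * iexp (- p * u) ^ (n - k)"
      by (simp only: exp_of_nat_mult[symmetric] exp_add[symmetric])
        (simp add: algebra_simps)
    then show "pmf (binomial_pmf n p) k *\<^sub>R iexp (t * ((real k - real n * p) / s))
       = of_nat (n choose k) * (complex_of_real p * iexp ((1 - p) * u)) ^ k
      * (complex_of_real (1 - p) * iexp (- p * u)) ^ (n - k)"
      using p k by (simp add: pmf_binomial scaleR_conv_of_real power_mult_distrib)
  qed simp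
  also have "\<dots> = (complex_of_real p * iexp ((1 - p) * u) + complex_of_real (1 - p) * iexp (- p * u)) ^ n"
    by (rule binomial_ring[symmetric])
  finally show ?thesis by (simp only: u_def)
qed

text \<open>Average the second-order Taylor polynomials of the two exponentials: the linear terms
  cancel because the mean is 0, and the quadratic ones add up to the variance
  \<open>p * (1 - p)\<close>. Each cubic remainder is at most \<open>\<bar>u\<bar> ^ 3 / 6\<close>,
  since \<open>p\<close> and \<open>1 - p\<close> lie in the unit interval.\<close>

lemma cmod_centred_bernoulli_char_approx:
  assumes p: "0 \<le> p" "p \<le> 1"
  shows "cmod (complex_of_real p * iexp ((1 - p) * u) + complex_of_real (1 - p) * iexp (- p * u)
      - complex_of_real (1 - p * (1 - p) * u\<^sup>2 / 2)) \<le> \<bar>u\<bar> ^ 3"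
proof -
  define T where "T x = 1 + \<i> * complex_of_real x - complex_of_real (x\<^sup>2 / 2)" for x
  have T: "cmod (iexp (c * u) - T (c * u)) \<le> \<bar>u\<bar> ^ 3" if "\<bar>c\<bar> \<le> 1" for c
  proof -
    have "(\<Sum>k\<le>2. (\<i> * complex_of_real (c * u)) ^ k / fact k) = T (c * u)"
      by (simp add: T_def numeral_2_eq_2 power_mult_distrib)
    then have "cmod (iexp (c * u) - T (c * u)) \<le> \<bar>c * u\<bar> ^ 3 / 6"
      using iexp_approx1[of "c * u" 2] by (simp add: fact_numeral)
    also have "\<dots> \<le> \<bar>u\<bar> ^ 3"
    proof -
      have "\<bar>c * u\<bar> ^ 3 \<le> \<bar>u\<bar> ^ 3"
        using that by (intro power_mono) (auto simp: abs_mult mult_left_le_one_le)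
      then show ?thesis using zero_le_power[of "\<bar>u\<bar>" 3] by linarith
    qed
    finally show ?thesis .
  qed
  have scale: "cmod (complex_of_real r * z) \<le> r * b" if "0 \<le> r" "cmod z \<le> b" for r z b
    using that by (simp add: norm_mult mult_left_mono)
  have "complex_of_real p * iexp ((1 - p) * u) + complex_of_real (1 - p) * iexp (- p * u)
      - complex_of_real (1 - p * (1 - p) * u\<^sup>2 / 2)
    = complex_of_real p * (iexp ((1 - p) * u) - T ((1 - p) * u))
      + complex_of_real (1 - p) * (iexp (- p * u) - T (- p * u))"
    by (simp add: T_def power2_eq_square field_simps)
  also have "cmod \<dots> \<le> p * \<bar>u\<bar> ^ 3 + (1 - p) * \<bar>u\<bar> ^ 3"
    using p by (intro norm_triangle_mono scale T) auto
  finally show ?thesis by (simp add: algebra_simps)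
qed

text \<open>By Levy's continuity theorem it suffices to treat characteristic functions. These are
  powers \<open>\<phi> n ^ n\<close>, compared with \<open>w n ^ n\<close>, whose limit is the
  Gaussian characteristic function.\<close>

theorem de_Moivre_Laplace:
  assumes p: "0 < p" "p < 1"
  shows "weak_conv_m (\<lambda>n. distr (measure_pmf (binomial_pmf n p)) borel
      (\<lambda>k. (real k - real n * p) / sqrt (real n * p * (1 - p)))) std_normal_distribution"
proof (rule levy_continuity)
  fix t :: real
  define v where "v = p * (1 - p)"
  have v: "v > 0" using p by (simp add: v_def)
  define s where "s n = sqrt (real n * v)" for n
  define \<phi> where "\<phi> n = complex_of_real p * iexp ((1 - p) * (t / s n))
        + complex_of_real (1 - p) * iexp (- p * (t / s n))" for n
  \<comment> \<open>This is the second-order approximation of \<open>\<phi> n\<close>: the variance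
    cancels against \<open>v\<close> in \<open>(s n)\<^sup>2 = n * v\<close>.\<close>
  define w where "w n = 1 + (- t\<^sup>2 / 2) / real n" for n
  have "\<forall>\<^sub>F n in sequentially. cmod (\<phi> n ^ n - complex_of_real (w n ^ n)) \<le> real n * \<bar>t / s n\<bar> ^ 3"
    \<comment> \<open>The bound \<open>t\<^sup>2 \<le> n\<close> keeps \<open>w n\<close> in the
      unit interval. For two numbers in the closed unit disc, the \<open>n\<close>-th powers differ
      by at most \<open>n\<close> times the difference of the numbers.\<close>
    using eventually_ge_at_top[of "nat \<lceil>t\<^sup>2\<rceil>"] eventually_gt_at_top[of 0]
  proof eventually_elim
    case (elim n)
    then have n: "real n > 0" "t\<^sup>2 \<le> real n" by linarith+
    have "p * (1 - p) * (t / s n)\<^sup>2 / 2 = t\<^sup>2 / 2 / real n"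
      using n p by (simp add: s_def v_def power_divide)
    then have *: "cmod (\<phi> n - complex_of_real (w n)) \<le> \<bar>t / s n\<bar> ^ 3"
      using cmod_centred_bernoulli_char_approx[of p "t / s n"] p
      by (simp only: \<phi>_def w_def) simp
    have "cmod (\<phi> n ^ n - complex_of_real (w n) ^ n) \<le> real n * cmod (\<phi> n - complex_of_real (w n))"
    proof (rule norm_power_diff)
      have "cmod (\<phi> n) \<le> p * 1 + (1 - p) * 1"
        unfolding \<phi>_def using p
        by (intro norm_triangle_mono) (simp_all add: norm_mult del: of_real_diff)
      then show "cmod (\<phi> n) \<le> 1" by simp
      have "t\<^sup>2 / 2 / real n \<le> 1" using n by (simp add: field_simps)
      moreover have "0 \<le> t\<^sup>2 / 2 / real n" by simp
      ultimately have "\<bar>w n\<bar> \<le> 1" by (simp add: w_def)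
      then show "cmod (complex_of_real (w n)) \<le> 1" by (simp only: norm_of_real)
    qed
    also have "\<dots> \<le> real n * \<bar>t / s n\<bar> ^ 3"
      using * by (intro mult_left_mono) auto
    finally show ?case by simp
  qed
  moreover have "(\<lambda>n. real n * \<bar>t / s n\<bar> ^ 3) \<longlonglongrightarrow> 0"
  proof -
    \<comment> \<open>Substituting \<open>n = (s n)\<^sup>2 / v\<close> shows that the error is of
      order \<open>1 / s n\<close>. At \<open>n = 0\<close> both sides vanish because
      \<open>inverse 0 = 0\<close>.\<close>
    have "real n * \<bar>t / s n\<bar> ^ 3 = \<bar>t\<bar> ^ 3 / v * inverse (s n)" for n
    proof (cases "n = 0")
      case False
      then have "s n > 0" "real n = (s n)\<^sup>2 / v" using v by (simp_all add: s_def)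
      then show ?thesis
        by (simp add: abs_divide power_divide power2_eq_square power3_eq_cube field_simps)
    qed (simp add: s_def)
    moreover have "filterlim s at_top sequentially"
      unfolding s_def using v
      by (intro filterlim_compose[OF sqrt_at_top]
        filterlim_at_top_mult_tendsto_pos[OF tendsto_const _ filterlim_real_sequentially])
    ultimately show ?thesis
      by (simp only:) (intro tendsto_mult_right_zero tendsto_inverse_0_at_top)
  qed
  ultimately have "(\<lambda>n. \<phi> n ^ n - complex_of_real (w n ^ n)) \<longlonglongrightarrow> 0"
    by (rule Lim_null_comparison)
  moreover have "(\<lambda>n. complex_of_real (w n ^ n)) \<longlonglongrightarrow> complex_of_real (exp (- t\<^sup>2 / 2))"
    unfolding w_def by (intro tendsto_of_real tendsto_exp_limit_sequentially)
  ultimately have "(\<lambda>n. \<phi> n ^ n) \<longlonglongrightarrow> complex_of_real (exp (- t\<^sup>2 / 2))"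
    by (rule Lim_transform[rotated])
  then show "(\<lambda>n. char (distr (measure_pmf (binomial_pmf n p)) borel
      (\<lambda>k. (real k - real n * p) / sqrt (real n * p * (1 - p)))) t) \<longlonglongrightarrow> char std_normal_distribution t"
    using p by (simp add: char_distr_binomial_pmf char_std_normal_distribution \<phi>_def s_def v_def mult.assoc)
next
  show "real_distribution (distr (measure_pmf (binomial_pmf n p)) borel
      (\<lambda>k. (real k - real n * p) / sqrt (real n * p * (1 - p))))" for n
    by (intro prob_space.real_distribution_distr) (auto intro: prob_space_measure_pmf)
qed (rule real_dist_normal_dist)

section \<open>The Hermite recurrence\<close>

lemma hermite_He_0: "hermite_He 0 x = 1"
  by (simp add: hermite_He_def)

lemma hermite_He_1: "hermite_He (Suc 0) x = x"
  by (simp add: hermite_He_def hermite_fps_factor fps_mult_nth fps_nth_compose_X_square)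

text \<open>Compare coefficients of degree \<open>d + 1\<close> in \<open>F' = (x - t) F\<close> for
  the generating function \<open>F\<close>; the factor \<open>fact (Suc d)\<close> restores the
  Hermite normalisation.\<close>

lemma hermite_He_Suc_Suc:
  "hermite_He (Suc (Suc d)) x = x * hermite_He (Suc d) x - real (Suc d) * hermite_He d x"
proof -
  define F :: "real fps" where
    "F = fps_exp 1 oo (fps_const x * fps_X - fps_const (1 / 2) * fps_X ^ 2)"
  have two: "fps_const (1 / 2 :: real) * 2 = 1"
    by (simp add: numeral_fps_const)
  have "fps_deriv F = (fps_const x - fps_X) * F"
    unfolding F_def using two by (simp add: fps_compose_deriv fps_deriv_power' flip: mult.assoc)
  then have "fps_nth (fps_deriv F) (Suc d) = fps_nth ((fps_const x - fps_X) * F) (Suc d)"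
    by simp
  then have "real (Suc (Suc d)) * fps_nth F (Suc (Suc d)) = x * fps_nth F (Suc d) - fps_nth F d"
    by (simp add: algebra_simps)
  then have "fact (Suc d) * (real (Suc (Suc d)) * fps_nth F (Suc (Suc d)))
      = fact (Suc d) * (x * fps_nth F (Suc d) - fps_nth F d)"
    by simp
  then show ?thesis
    unfolding hermite_He_def F_def[symmetric] by (simp add: algebra_simps)
qed

section \<open>Krawtchouk polynomials: generating function, recurrence and rescaling\<close>

lemma fps_nth_one_plus_const_X_power:
  fixes c :: "'a::comm_ring_1"
  shows "fps_nth ((1 + fps_const c * fps_X) ^ n) k = c ^ k * of_nat (n choose k)"
proof -
  have "(1 + fps_const c * fps_X) ^ n = (\<Sum>i\<le>n. fps_const (of_nat (n choose i) * c ^ i) * fps_X ^ i)"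
    by (subst add.commute, subst binomial_ring)
      (simp add: power_mult_distrib fps_const_power fps_of_nat[symmetric] mult.assoc[symmetric])
  also have "fps_nth \<dots> k = (\<Sum>i\<le>n. if i = k then of_nat (n choose i) * c ^ i else 0)"
    unfolding fps_sum_nth by (intro sum.cong) (auto simp: fps_X_power_mult_right_nth)
  also have "\<dots> = c ^ k * of_nat (n choose k)"
    by (auto simp: mult.commute binomial_eq_0)
  finally show ?thesis .
qed

lemma krawtchouk_generating_function:
  "krawtchouk q d h N
    = fps_nth ((1 + fps_const (- 1) * fps_X) ^ h * (1 + fps_const (real q - 1) * fps_X) ^ (N - h)) d"
proof -
  have "fps_nth ((1 + fps_const (- 1) * fps_X) ^ h * (1 + fps_const (real q - 1) * fps_X) ^ (N - h)) d
     = (\<Sum>j = 0..d. (-1) ^ j * real (h choose j) * ((real q - 1) ^ (d - j) * real ((N - h) choose (d - j))))"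
    unfolding fps_mult_nth fps_nth_one_plus_const_X_power ..
  \<comment> \<open>The terms with \<open>j > h\<close> vanish because \<open>h choose j\<close> is
    0 there.\<close>
  also have "\<dots> = (\<Sum>j = 0..min d h. (-1) ^ j * real (h choose j) * ((real q - 1) ^ (d - j) * real ((N - h) choose (d - j))))"
    by (rule sum.mono_neutral_right) auto
  finally show ?thesis
    unfolding krawtchouk_def by (simp add: mult_ac)
qed

lemma krawtchouk_1:
  assumes "h \<le> N"
  shows "krawtchouk q (Suc 0) h N = (real q - 1) * real N - real q * real h"
  unfolding krawtchouk_generating_function fps_mult_nth fps_nth_one_plus_const_X_power
  using assms by (simp add: of_nat_diff algebra_simps)

text \<open>Compare coefficients in \<open>(1 - t) (1 + (q - 1) t) G' = ((q - 1) N - q h - (q - 1) N t) G\<close>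
  for the generating function \<open>G = (1 - t)^h (1 + (q - 1) t)^(N - h)\<close>.\<close>

lemma krawtchouk_Suc_Suc:
  assumes h: "h \<le> N"
  shows "real (Suc (Suc d)) * krawtchouk q (Suc (Suc d)) h N
    = ((real q - 1) * real N - real q * real h + real (Suc d) * (2 - real q)) * krawtchouk q (Suc d) h N
      - (real q - 1) * (real N - real d) * krawtchouk q d h N"
proof -
  define c where "c = real q - 1"
  define A B G :: "real fps" where
    "A = 1 + fps_const (- 1) * fps_X" and "B = 1 + fps_const c * fps_X" and "G = A ^ h * B ^ (N - h)"
  have K: "krawtchouk q k h N = fps_nth G k" for k
    by (simp only: krawtchouk_generating_function G_def A_def B_def c_def)
  \<comment> \<open>Multiplying by \<open>Y\<close> avoids the exponent \<open>n - 1\<close>, so the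
    rule also covers \<open>n = 0\<close>. This is why the differential equation is cleared by the
    factor \<open>A * B\<close>.\<close>
  have P: "Y * fps_deriv (Y ^ n) = of_nat n * fps_deriv Y * Y ^ n" for Y :: "real fps" and n
    unfolding fps_deriv_power' by (cases n) (simp_all add: mult_ac del: of_nat_Suc)
  have "A * B * fps_deriv G = B * (A * fps_deriv (A ^ h)) * B ^ (N - h) + A * A ^ h * (B * fps_deriv (B ^ (N - h)))"
    by (simp add: G_def algebra_simps)
  also have "\<dots> = (of_nat h * fps_deriv A * B + of_nat (N - h) * fps_deriv B * A) * G"
    unfolding P by (simp add: G_def algebra_simps)
  also have "of_nat h * fps_deriv A * B + of_nat (N - h) * fps_deriv B * A
      = fps_const (c * real N - (c + 1) * real h) - fps_const (c * real N) * fps_X"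
  proof -
    have "fps_deriv A = fps_const (- 1)" "fps_deriv B = fps_const c"
      by (simp_all add: A_def B_def)
    then show ?thesis
      using h by (intro fps_ext)
        (simp add: A_def B_def fps_of_nat[symmetric] of_nat_diff fps_mult_left_const_nth mult.assoc algebra_simps)
  qed
  also have "A * B = 1 + fps_const (c - 1) * fps_X - fps_const c * fps_X * fps_X"
    by (simp add: A_def B_def algebra_simps flip: fps_const_sub)
  finally have "fps_nth ((1 + fps_const (c - 1) * fps_X - fps_const c * fps_X * fps_X) * fps_deriv G) (Suc d)
      = fps_nth ((fps_const (c * real N - (c + 1) * real h) - fps_const (c * real N) * fps_X) * G) (Suc d)"
    by simp
  then have "real (Suc (Suc d)) * fps_nth G (Suc (Suc d)) + (c - 1) * (real (Suc d) * fps_nth G (Suc d))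
        - c * (real d * fps_nth G d)
      = (c * real N - (c + 1) * real h) * fps_nth G (Suc d) - c * real N * fps_nth G d"
    \<comment> \<open>The quadratic term of \<open>A * B\<close> picks out coefficient
      \<open>d - 1\<close> of \<open>fps_deriv G\<close>. For \<open>d = 0\<close> there is none, in
      agreement with the factor \<open>real d\<close>.\<close>
    by (cases d) (simp_all add: ring_distribs mult.assoc)
  then show ?thesis
    unfolding K by (simp add: c_def algebra_simps)
qed

text \<open>With \<open>c = q - 1\<close>, this is \<open>d! K_d(h; N) / sqrt (c N)^d\<close> as a polynomial in
  \<open>x = (c N - q h) / sqrt (c N)\<close>.\<close>

fun scaled_krawtchouk :: "real \<Rightarrow> nat \<Rightarrow> nat \<Rightarrow> real \<Rightarrow> real" where
  "scaled_krawtchouk c N 0 x = 1"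
| "scaled_krawtchouk c N (Suc 0) x = x"
| "scaled_krawtchouk c N (Suc (Suc d)) x
    = (x + real (Suc d) * (1 - c) / sqrt (c * real N)) * scaled_krawtchouk c N (Suc d) x
      - real (Suc d) * (1 - real d / real N) * scaled_krawtchouk c N d x"

lemma borel_measurable_scaled_krawtchouk [measurable]:
  "scaled_krawtchouk c N d \<in> borel_measurable borel"
proof (induction d rule: induct_nat_012)
  case (ge2 d)
  note [measurable] = ge2
  show ?case by simp
qed simp_all

text \<open>Multiply the three-term recurrence by \<open>fact (Suc d)\<close> and extract one factor
  \<open>s = sqrt (c * N)\<close> per degree. With \<open>2 - q = 1 - c\<close> and
  \<open>c * (N - d) = s\<^sup>2 * (1 - d / N)\<close>, what remains is the recursion of
  \<open>scaled_krawtchouk\<close>.\<close>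

lemma krawtchouk_eq_scaled_krawtchouk:
  assumes q: "q \<ge> 2" and N: "N > 0" and h: "h \<le> N"
  shows "fact d * krawtchouk q d h N = sqrt ((real q - 1) * real N) ^ d
    * scaled_krawtchouk (real q - 1) N d
        (((real q - 1) * real N - real q * real h) / sqrt ((real q - 1) * real N))"
proof -
  define c s x where "c = real q - 1" and "s = sqrt (c * real N)"
    and "x = (c * real N - real q * real h) / s"
  have s: "s > 0" "s\<^sup>2 = c * real N" using q N by (simp_all add: s_def c_def)
  have sx: "c * real N - real q * real h = s * x" using s by (simp add: x_def)
  have "fact d * krawtchouk q d h N = s ^ d * scaled_krawtchouk c N d x"
  proof (induction d rule: induct_nat_012)
    case 0
    show ?case by (simp add: krawtchouk_0)
  next
    case 1
    show ?case using krawtchouk_1[OF h, of q] sx by (simp add: c_def)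
  next
    case (ge2 d)
    have "fact (Suc (Suc d)) * krawtchouk q (Suc (Suc d)) h N
        = fact (Suc d) * (real (Suc (Suc d)) * krawtchouk q (Suc (Suc d)) h N)"
      by (simp add: algebra_simps)
    also have "\<dots> = (s * x + real (Suc d) * (1 - c)) * (fact (Suc d) * krawtchouk q (Suc d) h N)
        - c * (real N - real d) * real (Suc d) * (fact d * krawtchouk q d h N)"
      unfolding krawtchouk_Suc_Suc[OF h] sx[symmetric] by (simp add: c_def algebra_simps)
    also have "\<dots> = (s * x + real (Suc d) * (1 - c)) * (s ^ Suc d * scaled_krawtchouk c N (Suc d) x)
        - c * (real N - real d) * real (Suc d) * (s ^ d * scaled_krawtchouk c N d x)"
      unfolding ge2 ..
    also have "s * x + real (Suc d) * (1 - c) = s * (x + real (Suc d) * (1 - c) / s)"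
      using s by (simp add: field_simps)
    also have "c * (real N - real d) = s\<^sup>2 * (1 - real d / real N)"
      using s N by (simp add: field_simps)
    finally show ?case
      by (simp add: s_def[symmetric] power2_eq_square algebra_simps)
  qed
  then show ?thesis by (simp add: s_def x_def c_def)
qed

section \<open>Limits of the rescaled polynomials and of the normalising factor\<close>

lemma tendsto_scaled_krawtchouk:
  assumes c: "c > 0" and X: "X \<longlonglongrightarrow> x"
  shows "(\<lambda>N. scaled_krawtchouk c N d (X N)) \<longlonglongrightarrow> hermite_He d x"
proof (induction d rule: induct_nat_012)
  case (ge2 d)
  \<comment> \<open>These are the two corrections by which the recursion differs from the Hermite
    recurrence.\<close>
  have "(\<lambda>N. real (Suc d) * (1 - c) / sqrt (c * real N)) \<longlonglongrightarrow> 0"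
    using c by real_asymp
  moreover have "(\<lambda>N. real d / real N) \<longlonglongrightarrow> 0"
    by real_asymp
  ultimately have "(\<lambda>N. scaled_krawtchouk c N (Suc (Suc d)) (X N))
      \<longlonglongrightarrow> (x + 0) * hermite_He (Suc d) x - real (Suc d) * (1 - 0) * hermite_He d x"
    unfolding scaled_krawtchouk.simps by (intro tendsto_intros X ge2)
  then show ?case by (simp add: hermite_He_Suc_Suc)
qed (use X in \<open>simp_all add: hermite_He_0 hermite_He_1\<close>)

text \<open>The binomial coefficient is \<open>N ^ d / fact d\<close> times the product of the
  \<open>d\<close> factors \<open>1 - i / N\<close>, each of which tends to 1.\<close>

lemma tendsto_power_over_binomial:
  "(\<lambda>N. real N ^ d / real (N choose d)) \<longlonglongrightarrow> fact d"
proof -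
  have "(\<lambda>N. \<Prod>i<d. 1 - real i / real N) \<longlonglongrightarrow> (\<Prod>i<d. 1 - 0)"
    by (intro tendsto_intros lim_const_over_n)
  moreover have "\<forall>\<^sub>F N in sequentially.
      (\<Prod>i<d. 1 - real i / real N) = real (N choose d) / (real N ^ d / fact d)"
    using eventually_gt_at_top[of 0]
  proof eventually_elim
    case (elim N)
    have "(\<Prod>i<d. 1 - real i / real N) = (\<Prod>i<d. (real N - real i) / real N)"
      using elim by (intro prod.cong) (auto simp: field_simps)
    also have "\<dots> = real (N choose d) / (real N ^ d / fact d)"
      by (simp add: binomial_gbinomial gbinomial_prod_rev prod_dividef atLeast0LessThan)
    finally show ?case .
  qed
  ultimately have "(\<lambda>N. real (N choose d) / (real N ^ d / fact d)) \<longlonglongrightarrow> 1"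
    by (simp add: tendsto_cong)
  then have "(\<lambda>N. fact d * inverse (real (N choose d) / (real N ^ d / fact d))) \<longlonglongrightarrow> fact d * inverse 1"
    by (intro tendsto_intros) auto
  then show ?thesis by (simp add: field_simps)
qed

section \<open>Convergence in distribution of the normalised Krawtchouk polynomials\<close>

theorem theorem4p4:
  fixes q d :: nat
    and M :: "nat \<Rightarrow> 'a measure" and W :: "nat \<Rightarrow> 'a \<Rightarrow> nat"
    and P :: "'b measure" and Z :: "'b \<Rightarrow> real"
  assumes q: "q \<ge> 2"
    and M: "\<And>N. N \<ge> 1 \<Longrightarrow> prob_space (M N)"
    and W_meas: "\<And>N. N \<ge> 1 \<Longrightarrow> W N \<in> measurable (M N) (count_space UNIV)"
    and W_binomial: "\<And>N. N \<ge> 1 \<Longrightarrow>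
      distr (M N) (count_space UNIV) (W N)
        = measure_pmf (binomial_pmf N ((real q - 1) / real q))"
    and P: "prob_space P"
    and Z_normal: "distributed P lborel Z (\<lambda>x. ennreal (std_normal_density x))"
  shows "weak_conv_m
      (\<lambda>N. distr (M N) borel
        (\<lambda>\<omega>. krawtchouk q d (W N \<omega>) N / sqrt ((real q - 1) ^ d * real (N choose d))))
      (distr P borel (\<lambda>\<omega>. hermite_He d (Z \<omega>) / sqrt (fact d)))"
proof -
  define c p where "c = real q - 1" and "p = c / real q"
  have c: "c > 0" and p: "0 < p" "p < 1" using q by (simp_all add: c_def p_def)
  have var: "real N * p * (1 - p) = c * real N / (real q)\<^sup>2" for N
    using q by (simp add: p_def c_def field_simps power2_eq_square)
  define \<mu> where "\<mu> N = distr (measure_pmf (binomial_pmf N p)) borel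
      (\<lambda>k. (real k - real N * p) / sqrt (real N * p * (1 - p)))" for N
  \<comment> \<open>The normalised Krawtchouk polynomial as a function of the standardised binomial
    value \<open>z\<close>. The square root is what remains of \<open>sqrt (c * N) ^ d\<close> after
    division by \<open>sqrt (c ^ d * (N choose d))\<close>.\<close>
  define f where "f N z = scaled_krawtchouk c N d (- z)
      * sqrt (real N ^ d / real (N choose d)) / fact d" for N z
  define g where "g z = hermite_He d (- z) / sqrt (fact d)" for z
  have f [measurable]: "f N \<in> borel_measurable borel" for N
    unfolding f_def by measurable
  have fg: "(\<lambda>N. f N (X N)) \<longlonglongrightarrow> g x" if "X \<longlonglongrightarrow> x" for X x
  proof -
    have "(\<lambda>N. f N (X N)) \<longlonglongrightarrow> hermite_He d (- x) * sqrt (fact d) / fact d"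
      unfolding f_def
      by (intro tendsto_intros tendsto_scaled_krawtchouk c that tendsto_power_over_binomial) simp
    also have "hermite_He d (- x) * sqrt (fact d) / fact d = g x"
      unfolding g_def by (simp add: field_simps flip: power2_eq_square)
    finally show ?thesis .
  qed
  \<comment> \<open>A Hermite polynomial is a pointwise limit of measurable functions: take
    \<open>c = 1\<close> and constant sequences of arguments.\<close>
  have He [measurable]: "hermite_He d \<in> borel_measurable borel"
    by (rule borel_measurable_LIMSEQ_real[OF tendsto_scaled_krawtchouk[OF zero_less_one tendsto_const]]) simp
  have g [measurable]: "g \<in> borel_measurable borel"
    unfolding g_def by measurable

  have "weak_conv_m (\<lambda>N. distr (\<mu> N) borel (f N)) (distr std_normal_distribution borel g)"
  proof (rule weak_conv_m_distr_varying[OF _ real_dist_normal_dist _ f g fg])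
    show "real_distribution (\<mu> N)" for N
      unfolding \<mu>_def by (intro prob_space.real_distribution_distr) (auto intro: prob_space_measure_pmf)
    show "weak_conv_m \<mu> std_normal_distribution"
      unfolding \<mu>_def by (rule de_Moivre_Laplace[OF p])
  qed
  \<comment> \<open>The reflection inside \<open>g\<close> is moved onto the Gaussian law, which is
    invariant under it.\<close>
  also have "distr std_normal_distribution borel g
      = distr (distr std_normal_distribution borel uminus) borel (\<lambda>z. hermite_He d z / sqrt (fact d))"
    by (subst distr_distr) (auto simp: comp_def g_def[abs_def])
  also have "\<dots> = distr (distr P lborel Z) borel (\<lambda>z. hermite_He d z / sqrt (fact d))"
    unfolding distr_std_normal_uminus distributed_distr_eq_density[OF Z_normal] ..
  also have "\<dots> = distr P borel (\<lambda>\<omega>. hermite_He d (Z \<omega>) / sqrt (fact d))"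
    using distributed_measurable[OF Z_normal] by (subst distr_distr) (auto simp: comp_def)
  finally have lim: "weak_conv_m (\<lambda>N. distr (\<mu> N) borel (f N))
      (distr P borel (\<lambda>\<omega>. hermite_He d (Z \<omega>) / sqrt (fact d)))" .

  have "distr (\<mu> N) borel (f N) = distr (M N) borel
      (\<lambda>\<omega>. krawtchouk q d (W N \<omega>) N / sqrt ((real q - 1) ^ d * real (N choose d)))" if N: "N \<ge> 1" for N
  proof -
    have eq: "f N ((real h - real N * p) / sqrt (real N * p * (1 - p)))
        = krawtchouk q d h N / sqrt ((real q - 1) ^ d * real (N choose d))" if h: "h \<le> N" for h
    proof -
      \<comment> \<open>For \<open>p = (q - 1) / q\<close> the standard deviation is
        \<open>sqrt (c * N) / q\<close>, and the deviation from the mean also carries a factor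
        \<open>1 / q\<close>; the two cancel.\<close>
      have "- ((real h - real N * p) / sqrt (real N * p * (1 - p)))
          = (c * real N - real q * real h) / sqrt (c * real N)"
      proof -
        have centre: "real h - real N * p = - (c * real N - real q * real h) / real q"
          using q by (simp add: p_def field_simps)
        have sd: "sqrt (real N * p * (1 - p)) = sqrt (c * real N) / real q"
          unfolding var by (simp add: real_sqrt_divide)
        have cancel: "- ((- y / b) / (r / b)) = y / r" if "b \<noteq> 0" for y r b :: real
          using that by simp
        show ?thesis
          unfolding centre sd by (rule cancel) (use q in simp)
      qed
      then have "f N ((real h - real N * p) / sqrt (real N * p * (1 - p)))
          = scaled_krawtchouk c N d ((c * real N - real q * real h) / sqrt (c * real N))
            * sqrt (real N ^ d / real (N choose d)) / fact d"
        by (simp add: f_def)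
      also have "scaled_krawtchouk c N d ((c * real N - real q * real h) / sqrt (c * real N))
          = fact d * krawtchouk q d h N / sqrt (c * real N) ^ d"
        using krawtchouk_eq_scaled_krawtchouk[OF q _ h, of d] N c by (simp add: c_def)
      \<comment> \<open>For \<open>N < d\<close> the binomial coefficient is 0, and both sides are 0
        by the convention for division by zero.\<close>
      also have "\<dots> * sqrt (real N ^ d / real (N choose d)) / fact d
          = krawtchouk q d h N / sqrt (c ^ d * real (N choose d))"
        using N c by (simp add: real_sqrt_divide real_sqrt_mult real_sqrt_power power_mult_distrib)
      finally show ?thesis by (simp only: c_def)
    qed
    have "distr (\<mu> N) borel (f N) = distr (measure_pmf (binomial_pmf N p)) borel
        (\<lambda>h. f N ((real h - real N * p) / sqrt (real N * p * (1 - p))))"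
      unfolding \<mu>_def by (subst distr_distr) (auto simp: comp_def)
    also have "\<dots> = distr (measure_pmf (binomial_pmf N p)) borel
        (\<lambda>h. krawtchouk q d h N / sqrt ((real q - 1) ^ d * real (N choose d)))"
      \<comment> \<open>The identity \<open>eq\<close> is available for \<open>h \<le> N\<close>
        only, which is enough because the binomial law lives on these values.\<close>
      using p by (intro distr_cong_AE) (auto simp: AE_measure_pmf_iff set_pmf_binomial_eq intro!: eq split: if_splits)
    also have "measure_pmf (binomial_pmf N p) = distr (M N) (count_space UNIV) (W N)"
      using W_binomial[OF N] by (simp add: p_def c_def)
    also have "distr \<dots> borel (\<lambda>h. krawtchouk q d h N / sqrt ((real q - 1) ^ d * real (N choose d)))
        = distr (M N) borel (\<lambda>\<omega>. krawtchouk q d (W N \<omega>) N / sqrt ((real q - 1) ^ d * real (N choose d)))"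
      using W_meas[OF N] by (subst distr_distr) (auto simp: comp_def)
    finally show ?thesis .
  qed
  \<comment> \<open>The assumptions start at \<open>N = 1\<close>, so the two sequences of laws are
    identified only from there on.\<close>
  then have "\<forall>\<^sub>F N in sequentially. distr (\<mu> N) borel (f N) = distr (M N) borel
      (\<lambda>\<omega>. krawtchouk q d (W N \<omega>) N / sqrt ((real q - 1) ^ d * real (N choose d)))"
    by (intro eventually_sequentiallyI)
  from weak_conv_m_cong[OF this] lim show ?thesis by blast
qed

end
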